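(* Consider the Capacitated Delivery Problem with Parking (CDPP) on the complete $\sqrt{n}\times\sqrt{n}$ grid of $n$ customers, where $\sqrt{n}$ is an even positive integer, with driving time per unit $\hat d$, walking time per unit $\hat w$ (where $\hat d\le \hat w$), block length $\hat l$ units, search time for parking $p\ge 0$ at every customer location, loading time $f\ge 0$ per package, and delivery person capacity of $q$ packages. Assume $q=3$. Then: (a) if $p\le \hat l\left(\tfrac43\hat w-\hat d\right)$, then an optimal solution to the CDPP is a TSP solution parking at every customer; (b) if $p>\hat l\left(\tfrac43\hat w-\hat d\right)$, then a TSP solution parking at every customer is not an optimal solution to the CDPP.
   Context: Grid setting. The depot, denoted $0$, is located at $(0,0)$. The set of customers is $C=\{1,\dots,\sqrt n\}\times\{1,\dots,\sqrt n\}$, so the bottom-left corner of the grid is $(1,1)$ and the top-right corner is $(\sqrt n,\sqrt n)$. Each customer requires one package. Adjacent grid points are one block apart, a block has length $\hat l>0$, and travel is along the grid: for points $a,b$ the driving time is $D(a,b)=\hat l\,\hat d\,\|a-b\|_1$ and the walking time is $W(a,b)=\hat l\,\hat w\,\|a-b\|_1$, with $0<\hat d\le\hat w$. The possible parking locations are exactly the customer locations. CDPP. A delivery person with a vehicle starts and ends at the depot. A feasible solution consists of: a nonempty sequence $(i_1,\dots,i_k)$ of distinct customer locations at which the vehicle parks, in this order; a partition of $C$ into nonempty service sets, each of size at most $q$; and an assignment of each service set to one of the parking locations $i_1,\dots,i_k$ (several service sets may be assigned to the same parking location). For a parking location $i$ and a service set $\sigma=\{c_1,\dots,c_m\}$,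 the walking time $w(i,\sigma)$ is the minimum over all orderings $(c_1,\dots,c_m)$ of $\sigma$ of $W(i,c_1)+W(c_1,c_2)+\cdots+W(c_{m-1},c_m)+W(c_m,i)$. The objective value (completion time) is $$D(0,i_1)+\sum_{r=1}^{k-1}D(i_r,i_{r+1})+D(i_k,0)+kp+\sum_{\sigma}w(i(\sigma),\sigma)+nf,$$ where the sum is over the service sets $\sigma$ and $i(\sigma)$ is the parking location to which $\sigma$ is assigned. An optimal solution is a feasible solution minimizing this objective. TSP solution parking at every customer. This is the feasible solution with $k=n$ in which the vehicle follows a tour of minimum total driving time through the depot and all customers (an optimal Traveling Salesman tour with respect to $D$), parks at every customer location, and each customer is served alone, as a singleton service set, from its own location.
   Formalization: Part (a) is stated only for even √n ≥ 4, because it fails on the 2×2 grid: with block length, driving and walking rates 1, p = 1/3 and f = 0, parking once at (1,1) costs 25/3 against 28/3 for the TSP solution; part (b) still includes √n = 2. *)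

theory Defs
  imports Complex_Main "HOL-Library.Disjoint_Sets"
begin

type_synonym point = "int \<times> int"

text \<open>The grid has \<open>n = side\<^sup>2\<close> customers, so \<open>side\<close> is \<open>\<surd>n\<close>.\<close>

record grid_cdpp =
  side :: nat
  block_length :: real
  drive_rate :: real
  walk_rate :: real
  park_time :: real
  load_time :: real
  capacity :: nat

definition depot :: point where
  "depot = (0, 0)"

definition customers :: "grid_cdpp \<Rightarrow> point set" where
  "customers I = {1..int (side I)} \<times> {1..int (side I)}"

definition l1_dist :: "point \<Rightarrow> point \<Rightarrow> real" where
  "l1_dist a b = real_of_int (\<bar>fst a - fst b\<bar> + \<bar>snd a - snd b\<bar>)"

definition drive :: "grid_cdpp \<Rightarrow> point \<Rightarrow> point \<Rightarrow> real" where
  "drive I a b = block_length I * drive_rate I * l1_dist a b"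

definition walk :: "grid_cdpp \<Rightarrow> point \<Rightarrow> point \<Rightarrow> real" where
  "walk I a b = block_length I * walk_rate I * l1_dist a b"

fun path_time :: "(point \<Rightarrow> point \<Rightarrow> real) \<Rightarrow> point list \<Rightarrow> real" where
  "path_time T (a # b # xs) = T a b + path_time T (b # xs)"
| "path_time T _ = 0"

definition round_trip :: "(point \<Rightarrow> point \<Rightarrow> real) \<Rightarrow> point \<Rightarrow> point list \<Rightarrow> real" where
  "round_trip T a xs = path_time T (a # xs @ [a])"

definition set_walk_time :: "grid_cdpp \<Rightarrow> point \<Rightarrow> point set \<Rightarrow> real" where
  "set_walk_time I i \<sigma> = Min (round_trip (walk I) i ` {cs. distinct cs \<and> set cs = \<sigma>})"

text \<open>The values of \<open>parked_at\<close> outside \<open>service_sets\<close> are irrelevant.\<close>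

record solution =
  route :: "point list"
  service_sets :: "point set set"
  parked_at :: "point set \<Rightarrow> point"

definition feasible :: "grid_cdpp \<Rightarrow> solution \<Rightarrow> bool" where
  "feasible I s \<longleftrightarrow>
     route s \<noteq> [] \<and> distinct (route s) \<and> set (route s) \<subseteq> customers I \<and>
     partition_on (customers I) (service_sets s) \<and>
     (\<forall>\<sigma>\<in>service_sets s. card \<sigma> \<le> capacity I) \<and>
     (\<forall>\<sigma>\<in>service_sets s. parked_at s \<sigma> \<in> set (route s))"

definition completion_time :: "grid_cdpp \<Rightarrow> solution \<Rightarrow> real" where
  "completion_time I s =
     round_trip (drive I) depot (route s) +
     real (length (route s)) * park_time I +
     (\<Sum>\<sigma>\<in>service_sets s. set_walk_time I (parked_at s \<sigma>) \<sigma>) +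
     real ((side I)\<^sup>2) * load_time I"

definition optimal :: "grid_cdpp \<Rightarrow> solution \<Rightarrow> bool" where
  "optimal I s \<longleftrightarrow> is_arg_min (completion_time I) (feasible I) s"

definition optimal_tsp_tour :: "grid_cdpp \<Rightarrow> point list \<Rightarrow> bool" where
  "optimal_tsp_tour I r \<longleftrightarrow>
     is_arg_min (round_trip (drive I) depot) (\<lambda>xs. distinct xs \<and> set xs = customers I) r"

definition tsp_solution :: "grid_cdpp \<Rightarrow> solution \<Rightarrow> bool" where
  "tsp_solution I s \<longleftrightarrow>
     feasible I s \<and> optimal_tsp_tour I (route s) \<and>
     service_sets s = (\<lambda>c. {c}) ` customers I \<and>
     (\<forall>c\<in>customers I. parked_at s {c} = c)"

text \<open>
  On the 2-by-2 grid the tour that parks everywhere need not be optimal for parking times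
  below the threshold, so \<open>side = 2\<close> must be excluded there: parking once at (1,1) drives only 4 blocks
  (first and last stop coincide), and the other three customers form one service set with a
  walk of 4 blocks. For drive and walk rate 1 and parking time 1/3 this costs 25/3,
  against 28/3.
\<close>

lemma side_two_counterexample:
  fixes I :: grid_cdpp
  defines "I \<equiv> \<lparr>side = 2, block_length = 1, drive_rate = 1, walk_rate = 1,
                park_time = 1/3, load_time = 0, capacity = 3\<rparr>"
  shows "park_time I \<le> block_length I * (4/3 * walk_rate I - drive_rate I)"
    and "\<not> (\<exists>s. optimal I s \<and> tsp_solution I s)"
proof -
  show "park_time I \<le> block_length I * (4/3 * walk_rate I - drive_rate I)"
    by (simp add: I_def)
  have C: "customers I = {(1,1),(1,2),(2,1),(2,2)}"
  proof -
    have "{1..int 2} = {1,2}" by auto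
    moreover have "side I = 2" by (simp add: I_def)
    ultimately have "customers I = {1,2} \<times> {1,2}" by (simp only: customers_def)
    then show ?thesis by auto
  qed
  define S3 where "S3 = {(1,2),(2,2),(2,1::int)::point}"
  define t where "t = \<lparr>route = [(1,1)], service_sets = {{(1,1)}, S3}, parked_at = (\<lambda>_. (1,1))\<rparr>"
  have fin: "finite {cs. distinct cs \<and> set cs = A}" if "finite A" for A :: "point set"
    using finite_subset_distinct[OF that] by (rule finite_subset[rotated]) auto
  have cap: "capacity I = 3" by (simp add: I_def)
  have tf: "feasible I t"
    using cap by (auto simp: feasible_def t_def C S3_def partition_on_def disjoint_def)
  have w_le: "set_walk_time I i A \<le> round_trip (walk I) i cs"
    if "distinct cs" "set cs = A" for i A cs
    unfolding set_walk_time_def using that fin[of A] by (intro Min_le) auto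
  have w1: "set_walk_time I (1,1) {(1,1)} \<le> 0"
    using w_le[of "[(1,1)]" "{(1,1)}" "(1,1)"]
    by (simp add: round_trip_def walk_def l1_dist_def)
  have w3: "set_walk_time I (1,1) S3 \<le> 4"
    using w_le[of "[(1,2),(2,2),(2,1)]" S3 "(1,1)"]
    by (simp add: round_trip_def walk_def l1_dist_def S3_def I_def)
  have "{(1,1)} \<noteq> S3" by (auto simp: S3_def)
  then have tc: "completion_time I t \<le> 25/3"
    using w1 w3
    by (simp add: completion_time_def t_def round_trip_def drive_def l1_dist_def depot_def I_def)
  show "\<not> (\<exists>s. optimal I s \<and> tsp_solution I s)"
  proof
    assume "\<exists>s. optimal I s \<and> tsp_solution I s"
    then obtain s where opt: "optimal I s" and tsp: "tsp_solution I s" by blast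
    have r: "distinct (route s)" "set (route s) = customers I"
      using tsp by (auto simp: tsp_solution_def optimal_tsp_tour_def is_arg_min_def)
    then have len: "length (route s) = 4"
      using distinct_card[of "route s"] by (simp add: C)
    then obtain a b c e where rs: "route s = [a,b,c,e]"
      by (auto simp: numeral_eq_Suc length_Suc_conv)
    have mem: "a \<in> customers I" "b \<in> customers I" "c \<in> customers I" "e \<in> customers I"
      using r(2) rs by auto
    have drv: "round_trip (drive I) depot (route s) \<ge> 8"
    proof -
      have step: "l1_dist x y \<ge> 1" if "x \<noteq> y" for x y :: point
        using that unfolding l1_dist_def by (cases x; cases y) auto
      have "l1_dist a b \<ge> 1" "l1_dist b c \<ge> 1" "l1_dist c e \<ge> 1" "a \<noteq> e"
        using r(1) step unfolding rs by auto
      moreover have "l1_dist depot a + l1_dist e depot \<ge> 5"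
        using mem(1,4) \<open>a \<noteq> e\<close> unfolding C by (auto simp: l1_dist_def depot_def)
      ultimately show ?thesis
        by (simp add: rs round_trip_def drive_def I_def)
    qed
    have "set_walk_time I (parked_at s \<sigma>) \<sigma> \<ge> 0" if \<sigma>: "\<sigma> \<in> service_sets s" for \<sigma>
    proof -
      obtain c where c: "\<sigma> = {c}"
        using \<sigma> tsp by (auto simp: tsp_solution_def)
      have "path_time (walk I) xs \<ge> 0" for xs
        by (induction "walk I" xs rule: path_time.induct) (auto simp: walk_def l1_dist_def I_def)
      then show ?thesis
        unfolding set_walk_time_def using fin[of \<sigma>] c
        by (subst Min_ge_iff) (auto simp: round_trip_def intro!: exI[of _ "[c]"])
    qed
    then have "completion_time I s \<ge> 28/3"
      using drv sum_nonneg[of "service_sets s" "\<lambda>\<sigma>. set_walk_time I (parked_at s \<sigma>) \<sigma>"]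
      by (simp add: completion_time_def len I_def)
    then show False
      using opt tf tc by (auto simp: optimal_def is_arg_min_def not_less)
  qed
qed

end

theory Submission
  imports Defs
begin

text \<open>
  Measure distances in blocks and write \<open>d\<close>, \<open>w\<close> for the driving and walking time per block.
  A closed tour from the depot through \<open>k \<ge> 2\<close> customers has length at least \<open>k + 4\<close>: its first
  and last stops are distinct, so they are together at least 5 away from the depot, and the
  remaining \<open>k - 1\<close> steps have length at least 1. A closed walk from a stop through \<open>m \<ge> 1\<close> other
  points has length at least \<open>m + 1\<close>, which is at least \<open>4/3 m\<close> when \<open>m \<le> 3\<close>. So not parking at a
  customer saves at most \<open>d + p\<close> and costs at least \<open>4/3 w\<close> of walking, and the threshold
  \<open>p = 4/3 w - d\<close> is where the two balance.

  At or below the threshold, \<open>completion_time_ge\<close> turns this into a lower bound for every feasible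
  solution. The one exception to \<open>k + 4\<close> is a single stop, where first and last stop coincide and
  the tour can have length 4 instead of 5. For \<open>side \<ge> 4\<close> some customer is then at least 4 blocks
  away from the stop, and walking there costs more than the one block of driving that was gained.
  The bound is attained because a grid of even side has a path of unit steps through all customers
  from (1,1) to (1,2) (\<open>unit_path_whole_grid\<close>).

  Above the threshold, it suffices to exhibit one cheaper solution (\<open>walking_beats_tsp\<close>). When \<open>p\<close> is
  only slightly larger, both bounds must be met with equality, so a service set should consist of
  the three other corners of a unit square with the stop, and the tour should consist of unit
  steps except at the depot. A closed tour has even length, so such tours exist only for an even
  number of stops. A unit square takes 3 stops away from the even number \<open>n\<close>, hence two of them are
  used at once (\<open>unit_path_without_trominoes\<close>). The solution has 6 stops fewer and 8 blocks of
  walking, so it is cheaper by \<open>6 (p + d) - 8 w > 0\<close>. On the 2-by-2 grid, parking only at (1,1) is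
  cheaper.
\<close>

section \<open>Lengths of paths and closed walks\<close>

lemma l1_dist_ge_0: "l1_dist a b \<ge> 0"
  by (simp add: l1_dist_def)

lemma l1_dist_ge_1: "a \<noteq> b \<Longrightarrow> l1_dist a b \<ge> 1"
  unfolding l1_dist_def by (cases a; cases b) auto

lemma l1_dist_commute: "l1_dist a b = l1_dist b a"
  by (simp add: l1_dist_def abs_minus_commute)

lemma l1_dist_triangle: "l1_dist a c \<le> l1_dist a b + l1_dist b c"
  unfolding l1_dist_def by linarith

lemma path_time_scale: "path_time (\<lambda>a b. c * T a b) xs = c * path_time T xs"
  by (induction T xs rule: path_time.induct) (auto simp: algebra_simps)

lemma round_trip_drive:
  "round_trip (drive I) a xs = block_length I * drive_rate I * round_trip l1_dist a xs"
proof -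
  have "drive I = (\<lambda>a b. (block_length I * drive_rate I) * l1_dist a b)"
    by (intro ext) (simp add: drive_def)
  then show ?thesis by (simp only: round_trip_def path_time_scale)
qed

lemma round_trip_walk:
  "round_trip (walk I) a xs = block_length I * walk_rate I * round_trip l1_dist a xs"
proof -
  have "walk I = (\<lambda>a b. (block_length I * walk_rate I) * l1_dist a b)"
    by (intro ext) (simp add: walk_def)
  then show ?thesis by (simp only: round_trip_def path_time_scale)
qed

lemma path_time_split:
  "path_time T (xs @ a # ys) = path_time T (xs @ [a]) + path_time T (a # ys)"
proof (induction xs)
  case (Cons x xs)
  then show ?case by (cases xs) auto
qed (cases ys; simp)

lemma path_time_append:
  assumes "xs \<noteq> []" "ys \<noteq> []"
  shows "path_time T (xs @ ys) = path_time T xs + T (last xs) (hd ys) + path_time T ys"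
  using assms
proof (induction xs)
  case (Cons x xs)
  then show ?case by (cases xs; cases ys) auto
qed simp

lemma path_time_ge_0: "path_time l1_dist xs \<ge> 0"
  by (induction l1_dist xs rule: path_time.induct) (auto simp: l1_dist_ge_0)

lemma path_time_distinct:
  "distinct xs \<Longrightarrow> path_time l1_dist xs \<ge> real (length xs) - 1"
proof (induction l1_dist xs rule: path_time.induct)
  case (1 a b xs)
  then show ?case using l1_dist_ge_1[of a b] by auto
qed auto

lemma path_time_ge_ends: "path_time l1_dist (a # xs @ [b]) \<ge> l1_dist a b"
proof (induction xs arbitrary: a)
  case (Cons x xs)
  have "l1_dist x b \<le> path_time l1_dist (x # xs @ [b])" by (rule Cons.IH)
  then show ?case using l1_dist_triangle[of a b x] by simp
qed simp

lemma round_trip_split: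
  "round_trip T a (xs @ c # ys) = path_time T (a # xs @ [c]) + path_time T (c # ys @ [a])"
  using path_time_split[of T "a # xs" c "ys @ [a]"] by (simp add: round_trip_def)

lemma round_trip_ge_far:
  assumes "c \<in> set cs"
  shows "round_trip l1_dist a cs \<ge> 2 * l1_dist a c"
proof -
  obtain xs ys where "cs = xs @ c # ys" using split_list[OF assms] by blast
  then show ?thesis
    using path_time_ge_ends[of a c xs] path_time_ge_ends[of c a ys]
    by (simp add: round_trip_split l1_dist_commute)
qed

text \<open>
  The walk makes one step more than it visits points, and each step joins distinct points.
\<close>

lemma round_trip_ge_length:
  assumes "distinct cs" "a \<notin> set cs" "cs \<noteq> []"
  shows "round_trip l1_dist a cs \<ge> real (length cs) + 1"
proof -
  have "path_time l1_dist (cs @ [a]) \<ge> real (length (cs @ [a])) - 1"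
    using assms by (intro path_time_distinct) auto
  moreover have "l1_dist a (hd cs) \<ge> 1" using assms by (intro l1_dist_ge_1) auto
  moreover have "round_trip l1_dist a cs = l1_dist a (hd cs) + path_time l1_dist (cs @ [a])"
    using assms(3) by (cases cs) (auto simp: round_trip_def)
  ultimately show ?thesis by simp
qed

text \<open>
  If the walk passes through its base point \<open>a\<close>, it falls into two closed walks at \<open>a\<close>, each of which
  satisfies the bound or is empty.
\<close>

lemma round_trip_ge_card:
  assumes "distinct cs" "card (set cs - {a}) > 0"
  shows "round_trip l1_dist a cs \<ge> real (card (set cs - {a})) + 1"
proof (cases "a \<in> set cs")
  case False
  then show ?thesis using assms round_trip_ge_length[of cs a] distinct_card[of cs] by auto
next
  case True
  then obtain xs ys where cs: "cs = xs @ a # ys" using split_list by metis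
  have tour: "round_trip l1_dist a cs = round_trip l1_dist a xs + round_trip l1_dist a ys"
    unfolding cs round_trip_split by (simp add: round_trip_def)
  have "set cs - {a} = set xs \<union> set ys" "set xs \<inter> set ys = {}"
    using assms(1) cs by auto
  then have "card (set cs - {a}) = length xs + length ys"
    using assms(1) cs by (simp add: card_Un_disjoint distinct_card)
  moreover have "round_trip l1_dist a zs \<ge> 0" for zs
    by (simp add: round_trip_def path_time_ge_0)
  moreover have "xs = [] \<or> round_trip l1_dist a xs \<ge> real (length xs) + 1"
    "ys = [] \<or> round_trip l1_dist a ys \<ge> real (length ys) + 1"
    using round_trip_ge_length[of xs a] round_trip_ge_length[of ys a] assms(1) cs by auto
  moreover have "round_trip l1_dist a [] = 0" by (simp add: round_trip_def l1_dist_def)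
  ultimately show ?thesis using assms(2) tour by auto
qed

text \<open>
  At most one of the two end stops is (1,1), at distance 2 from the depot; every other customer is
  at distance at least 3. This is where at least two stops are required.
\<close>

lemma depot_round_trip_ge:
  assumes "distinct r" "set r \<subseteq> customers I" "length r \<ge> 2"
  shows "round_trip l1_dist depot r \<ge> real (length r) + 4"
proof -
  have r: "r \<noteq> []" using assms(3) by auto
  have ends: "hd r \<in> customers I" "last r \<in> customers I" using r assms(2) by auto
  have "hd r \<noteq> last r"
    using assms(1,3) by (cases r rule: rev_cases; cases "butlast r") auto
  then have "l1_dist depot (hd r) + l1_dist (last r) depot \<ge> 5"
    using ends by (cases "hd r"; cases "last r") (auto simp: l1_dist_def depot_def customers_def)
  moreover have "round_trip l1_dist depot r
      = l1_dist depot (hd r) + path_time l1_dist r + l1_dist (last r) depot"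
    using r path_time_append[of "[depot]" "r @ [depot]" l1_dist]
      path_time_append[of r "[depot]" l1_dist]
    by (simp add: round_trip_def)
  ultimately show ?thesis using path_time_distinct[OF assms(1)] by linarith
qed

section \<open>Walking times of service sets\<close>

lemma finite_orderings: "finite {cs. distinct cs \<and> set cs = \<sigma>}"
proof (cases "finite \<sigma>")
  case True
  then show ?thesis
    using finite_subset_distinct[OF True] by (rule_tac finite_subset[rotated]) auto
next
  case False
  then have "{cs. distinct cs \<and> set cs = \<sigma>} = {}" by auto
  then show ?thesis by (simp only: finite.emptyI)
qed

lemma set_walk_time_le:
  assumes "distinct cs" "set cs = \<sigma>"
  shows "set_walk_time I i \<sigma> \<le> round_trip (walk I) i cs"
  unfolding set_walk_time_def using assms by (intro Min_le finite_imageI finite_orderings) auto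

lemma set_walk_time_attained:
  assumes "finite \<sigma>"
  obtains cs where "distinct cs" "set cs = \<sigma>"
    "set_walk_time I i \<sigma> = block_length I * walk_rate I * round_trip l1_dist i cs"
proof -
  have "set_walk_time I i \<sigma> \<in> round_trip (walk I) i ` {cs. distinct cs \<and> set cs = \<sigma>}"
    unfolding set_walk_time_def using finite_distinct_list[OF assms]
    by (intro Min_in finite_imageI finite_orderings) auto
  then show ?thesis using that by (auto simp: round_trip_walk)
qed

lemma set_walk_time_ge_far:
  assumes "finite \<sigma>" "c \<in> \<sigma>" "block_length I * walk_rate I \<ge> 0"
  shows "set_walk_time I i \<sigma> \<ge> block_length I * walk_rate I * (2 * l1_dist i c)"
  using assms
  by (elim set_walk_time_attained[of \<sigma> I i]) (auto intro!: mult_left_mono round_trip_ge_far)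

text \<open>
  The capacity 3 enters here: a walk to \<open>m\<close> points away from the stop has length at least \<open>m + 1\<close>, and
  \<open>m + 1 \<ge> 4/3 m\<close> exactly for \<open>m \<le> 3\<close>.
\<close>

lemma set_walk_time_ge_card:
  assumes "finite \<sigma>" "card \<sigma> \<le> 3" "block_length I * walk_rate I \<ge> 0"
  shows "set_walk_time I i \<sigma> \<ge> block_length I * walk_rate I * (4/3 * real (card (\<sigma> - {i})))"
proof -
  obtain cs where cs: "distinct cs" "set cs = \<sigma>"
    "set_walk_time I i \<sigma> = block_length I * walk_rate I * round_trip l1_dist i cs"
    using set_walk_time_attained[OF assms(1)] by metis
  have "card (\<sigma> - {i}) \<le> 3"
    using assms(1,2) card_mono[of \<sigma> "\<sigma> - {i}"] by auto
  moreover have "round_trip l1_dist i cs \<ge> 0" by (simp add: round_trip_def path_time_ge_0)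
  ultimately have "round_trip l1_dist i cs \<ge> 4/3 * real (card (\<sigma> - {i}))"
    using round_trip_ge_card[OF cs(1), of i] cs(2) by (cases "card (\<sigma> - {i}) = 0") auto
  then show ?thesis unfolding cs(3) using assms(3) by (rule mult_left_mono)
qed

section \<open>A lower bound for every feasible solution\<close>

lemma card_customers: "card (customers I) = (side I)\<^sup>2"
  by (simp add: customers_def card_cartesian_product power2_eq_square)

lemma finite_customers: "finite (customers I)"
  by (simp add: customers_def)

lemma feasible_finite:
  assumes "feasible I s"
  shows "finite (service_sets s)" "\<sigma> \<in> service_sets s \<Longrightarrow> finite \<sigma>"
proof -
  have "partition_on (customers I) (service_sets s)" using assms by (simp add: feasible_def)
  then have sub: "\<sigma> \<subseteq> customers I" if "\<sigma> \<in> service_sets s" for \<sigma>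
    using that by (auto simp: partition_on_def)
  then show "finite (service_sets s)"
    using finite_customers by (meson PowI finite_Pow_iff finite_subset subsetI)
  show "\<sigma> \<in> service_sets s \<Longrightarrow> finite \<sigma>" using sub finite_customers finite_subset by metis
qed

text \<open>
  A customer without a stop differs from the stop that serves it, so it is counted in its
  service set.
\<close>

lemma unparked_customers_walked:
  assumes "feasible I s"
  shows "real ((side I)\<^sup>2) - real (length (route s))
    \<le> (\<Sum>\<sigma>\<in>service_sets s. real (card (\<sigma> - {parked_at s \<sigma>})))"
proof -
  have r: "distinct (route s)" "set (route s) \<subseteq> customers I"
    and U: "\<Union>(service_sets s) = customers I"
    and p: "\<forall>\<sigma>\<in>service_sets s. parked_at s \<sigma> \<in> set (route s)"
    using assms by (auto simp: feasible_def partition_on_def)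
  let ?V = "\<Union>\<sigma>\<in>service_sets s. \<sigma> - {parked_at s \<sigma>}"
  have "customers I - set (route s) \<subseteq> ?V" using U p by blast
  moreover have "finite ?V" using feasible_finite[OF assms] by blast
  ultimately have "card (customers I - set (route s)) \<le> card ?V" by (rule card_mono[rotated])
  also have "\<dots> \<le> (\<Sum>\<sigma>\<in>service_sets s. card (\<sigma> - {parked_at s \<sigma>}))"
    using feasible_finite(1)[OF assms] by (rule card_UN_le)
  finally have "card (customers I - set (route s))
      \<le> (\<Sum>\<sigma>\<in>service_sets s. card (\<sigma> - {parked_at s \<sigma>}))" .
  moreover have "card (customers I - set (route s)) = (side I)\<^sup>2 - length (route s)"
    using r by (simp add: card_Diff_subset card_customers distinct_card)
  ultimately have "(side I)\<^sup>2 - length (route s)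
      \<le> (\<Sum>\<sigma>\<in>service_sets s. card (\<sigma> - {parked_at s \<sigma>}))" by simp
  then have "(side I)\<^sup>2 \<le> length (route s)
      + (\<Sum>\<sigma>\<in>service_sets s. card (\<sigma> - {parked_at s \<sigma>}))" by linarith
  then have "real ((side I)\<^sup>2) \<le> real (length (route s)
      + (\<Sum>\<sigma>\<in>service_sets s. card (\<sigma> - {parked_at s \<sigma>})))" by (simp only: of_nat_le_iff)
  then show ?thesis by (simp only: of_nat_add of_nat_sum)
qed

lemma far_customer:
  assumes "side I \<ge> 4"
  obtains c where "c \<in> customers I" "l1_dist i c \<ge> 4"
proof -
  define far where "far x = (if 2 * x \<le> int (side I) then int (side I) else 1)" for x
  have far: "far x \<in> {1..int (side I)}" "\<bar>x - far x\<bar> \<ge> 2" for x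
    using assms by (auto simp: far_def abs_if)
  have "(far (fst i), far (snd i)) \<in> customers I"
    using far(1) by (simp add: customers_def)
  moreover have "l1_dist i (far (fst i), far (snd i)) \<ge> 4"
    using far(2)[of "fst i"] far(2)[of "snd i"] by (simp add: l1_dist_def)
  ultimately show thesis by (rule that)
qed

text \<open>
  With \<open>k\<close> stops, driving takes at least \<open>d (k + 4)\<close>, parking \<open>k p\<close> and walking at least \<open>4/3 w (n - k)\<close>,
  so replacing \<open>k\<close> by \<open>n\<close> changes the bound by \<open>(n - k) (d + p - 4/3 w) \<le> 0\<close>.
\<close>

lemma completion_time_ge:
  assumes f: "feasible I s" and N: "side I \<ge> 4" and q: "capacity I = 3"
    and l: "block_length I > 0" and d: "0 < drive_rate I" and dw: "drive_rate I \<le> walk_rate I"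
    and p: "park_time I \<le> block_length I * (4/3 * walk_rate I - drive_rate I)"
  shows "completion_time I s \<ge> block_length I * drive_rate I * (real ((side I)\<^sup>2) + 4)
    + real ((side I)\<^sup>2) * park_time I + real ((side I)\<^sup>2) * load_time I"
proof -
  define D where "D = block_length I * drive_rate I"
  define W where "W = block_length I * walk_rate I"
  define n where "n = real ((side I)\<^sup>2)"
  define k where "k = real (length (route s))"
  define m where "m = (\<lambda>\<sigma>. real (card (\<sigma> - {parked_at s \<sigma>})))"
  define t where "t = (\<lambda>\<sigma>. set_walk_time I (parked_at s \<sigma>) \<sigma>)"
  let ?S = "service_sets s"
  have DW: "0 < D" "D \<le> W" using l d dw by (auto simp: D_def W_def)
  have pW: "park_time I \<le> 4/3 * W - D" using p by (simp add: D_def W_def algebra_simps)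
  have r: "route s \<noteq> []" "distinct (route s)" "set (route s) \<subseteq> customers I"
    and part: "\<Union>?S = customers I" and cap: "\<And>\<sigma>. \<sigma> \<in> ?S \<Longrightarrow> card \<sigma> \<le> 3"
    and pr: "\<And>\<sigma>. \<sigma> \<in> ?S \<Longrightarrow> parked_at s \<sigma> \<in> set (route s)"
    using f q by (auto simp: feasible_def partition_on_def)
  have fin: "finite ?S" "\<And>\<sigma>. \<sigma> \<in> ?S \<Longrightarrow> finite \<sigma>" using feasible_finite[OF f] by auto
  have tm: "t \<sigma> \<ge> W * (4/3 * m \<sigma>)" if "\<sigma> \<in> ?S" for \<sigma>
    unfolding t_def m_def W_def using that fin(2) cap DW
    by (intro set_walk_time_ge_card) (auto simp: W_def)
  have un: "n - k \<le> (\<Sum>\<sigma>\<in>?S. m \<sigma>)"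
    using unparked_customers_walked[OF f] by (simp add: n_def k_def m_def)
  have sums: "(\<Sum>\<sigma>\<in>?S. W * (4/3 * m \<sigma>)) = 4/3 * W * (\<Sum>\<sigma>\<in>?S. m \<sigma>)"
    by (subst sum_distrib_left) (simp add: mult_ac)
  have sumle: "4/3 * W * (n - k) \<le> 4/3 * W * (\<Sum>\<sigma>\<in>?S. m \<sigma>)"
    using un DW by (intro mult_left_mono) auto
  have kn: "k \<le> n"
    using card_mono[OF finite_customers r(3)] r(2)
    by (simp add: k_def n_def card_customers distinct_card del: of_nat_power)
  have main: "(n - k) * park_time I \<le> (n - k) * (4/3 * W - D)"
    using pW kn by (intro mult_left_mono) auto
  have total: "round_trip (drive I) depot (route s) + (\<Sum>\<sigma>\<in>?S. t \<sigma>)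
      \<ge> D * (k + 4) + 4/3 * W * (n - k)"
  proof (cases "length (route s) \<ge> 2")
    case True
    have "round_trip (drive I) depot (route s) \<ge> D * (k + 4)"
      unfolding round_trip_drive D_def[symmetric] k_def
      using depot_round_trip_ge[OF r(2,3) True] DW by (intro mult_left_mono) auto
    moreover have "(\<Sum>\<sigma>\<in>?S. t \<sigma>) \<ge> (\<Sum>\<sigma>\<in>?S. W * (4/3 * m \<sigma>))"
      by (intro sum_mono tm)
    ultimately show ?thesis using sums sumle by linarith
  next
    case False
    then obtain i where i: "route s = [i]" using r(1) by (cases "route s"; cases "tl (route s)") auto
    have ic: "i \<in> customers I" using i r(3) by simp
    \<comment> \<open>A single stop may drive only 4 blocks, one less than \<open>k + 4\<close>; the set that contains a far
      customer is walked for 8 blocks, at least 4 more than the bound \<open>4/3 m \<le> 4\<close> counts for it.\<close>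
    obtain c where c: "c \<in> customers I" "l1_dist i c \<ge> 4" using far_customer[OF N] by blast
    then obtain \<tau> where \<tau>: "\<tau> \<in> ?S" "c \<in> \<tau>" using part by auto
    have "parked_at s \<tau> = i" using pr[OF \<tau>(1)] i by simp
    then have "t \<tau> \<ge> W * (2 * l1_dist i c)"
      using set_walk_time_ge_far[of \<tau> c I i] fin(2) \<tau> DW by (auto simp: t_def W_def)
    moreover have "W * (2 * l1_dist i c) \<ge> W * 8" using c(2) DW by (intro mult_left_mono) auto
    moreover have "W * (4/3 * m \<tau>) \<le> W * 4"
      using cap[OF \<tau>(1)] card_mono[of \<tau> "\<tau> - {parked_at s \<tau>}"] fin(2)[OF \<tau>(1)] DW
      by (intro mult_left_mono) (auto simp: m_def)
    ultimately have "t \<tau> - W * (4/3 * m \<tau>) \<ge> D" using DW by linarith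
    moreover have "(\<Sum>\<sigma>\<in>?S - {\<tau>}. t \<sigma>) \<ge> (\<Sum>\<sigma>\<in>?S - {\<tau>}. W * (4/3 * m \<sigma>))"
      by (intro sum_mono tm) auto
    ultimately have walks: "(\<Sum>\<sigma>\<in>?S. t \<sigma>) \<ge> (\<Sum>\<sigma>\<in>?S. W * (4/3 * m \<sigma>)) + D"
      using sum.remove[OF fin(1) \<tau>(1), of t] sum.remove[OF fin(1) \<tau>(1), of "\<lambda>\<sigma>. W * (4/3 * m \<sigma>)"]
      by linarith
    have "l1_dist depot i \<ge> 2" using ic by (cases i) (auto simp: l1_dist_def depot_def customers_def)
    then have "round_trip l1_dist depot (route s) \<ge> 4"
      using round_trip_ge_far[of i "route s" depot] i by simp
    then have "round_trip (drive I) depot (route s) \<ge> D * 4"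
      unfolding round_trip_drive D_def[symmetric] using DW by (intro mult_left_mono) auto
    moreover have "k = 1" "D * (k + 4) = D * 4 + D * k" using i by (simp_all add: k_def algebra_simps)
    ultimately show ?thesis using walks sums sumle by simp
  qed
  have "completion_time I s = round_trip (drive I) depot (route s) + k * park_time I
      + (\<Sum>\<sigma>\<in>?S. t \<sigma>) + n * load_time I"
    by (simp add: completion_time_def n_def k_def t_def)
  also have "\<dots> \<ge> D * (n + 4) + n * park_time I + n * load_time I"
    using total main by (simp add: algebra_simps)
  finally show ?thesis by (simp only: D_def n_def)
qed

section \<open>Paths of unit steps\<close>

text \<open>
  A Hamiltonian path, from \<open>a\<close> to \<open>b\<close>, of the grid graph induced on \<open>A\<close>. As steps between distinct
  points have length at least 1, total length equal to the number of steps forces unit steps.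
\<close>

definition unit_path :: "point set \<Rightarrow> point \<Rightarrow> point \<Rightarrow> bool" where
  "unit_path A a b \<longleftrightarrow> (\<exists>xs. xs \<noteq> [] \<and> distinct xs \<and> set xs = A \<and> hd xs = a \<and> last xs = b \<and>
     path_time l1_dist xs = real (length xs) - 1)"

lemma unit_path_single: "unit_path {a} a a"
  unfolding unit_path_def by (intro exI[of _ "[a]"]) simp

lemma unit_path_append:
  assumes "unit_path A a b" "unit_path B c d" "l1_dist b c = 1" "A \<inter> B = {}"
  shows "unit_path (A \<union> B) a d"
proof -
  obtain xs ys where
    "xs \<noteq> []" "distinct xs" "set xs = A" "hd xs = a" "last xs = b"
      "path_time l1_dist xs = real (length xs) - 1" and
    "ys \<noteq> []" "distinct ys" "set ys = B" "hd ys = c" "last ys = d"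
      "path_time l1_dist ys = real (length ys) - 1"
    using assms(1,2) unfolding unit_path_def by blast
  then show ?thesis
    unfolding unit_path_def using assms(3,4)
    by (intro exI[of _ "xs @ ys"]) (simp add: path_time_append)
qed

lemma unit_path_column_up:
  assumes "l \<le> u"
  shows "unit_path ({x} \<times> {l..u}) (x, l) (x, u)"
  using assms
proof (induction u rule: int_ge_induct)
  case base
  then show ?case using unit_path_single[of "(x, l)"] by simp
next
  case (step u)
  have "unit_path ({x} \<times> {l..u} \<union> {(x, u + 1)}) (x, l) (x, u + 1)"
    using step by (intro unit_path_append[OF step.IH unit_path_single]) (auto simp: l1_dist_def)
  moreover have "{x} \<times> {l..u} \<union> {(x, u + 1)} = {x} \<times> {l..u + 1}" using step by auto
  ultimately show ?case by simp
qed

lemma l1_dist_swap: "l1_dist (prod.swap a) (prod.swap b) = l1_dist a b"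
  by (simp add: l1_dist_def)

lemma unit_path_swap:
  assumes "unit_path A a b"
  shows "unit_path (prod.swap ` A) (prod.swap a) (prod.swap b)"
proof -
  have pt: "path_time l1_dist (map prod.swap xs) = path_time l1_dist xs" for xs
    by (induction l1_dist xs rule: path_time.induct) (auto simp: l1_dist_swap)
  obtain xs where "xs \<noteq> []" "distinct xs" "set xs = A" "hd xs = a" "last xs = b"
      "path_time l1_dist xs = real (length xs) - 1"
    using assms unfolding unit_path_def by blast
  then show ?thesis
    unfolding unit_path_def
    by (intro exI[of _ "map prod.swap xs"]) (simp add: pt hd_map last_map distinct_map)
qed

lemma unit_path_rev:
  assumes "unit_path A a b"
  shows "unit_path A b a"
proof -
  have pt: "path_time l1_dist (rev xs) = path_time l1_dist xs" for xs
    by (induction l1_dist xs rule: path_time.induct)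
      (auto simp: path_time_split[of _ _ _ "[_]"] l1_dist_commute)
  obtain xs where "xs \<noteq> []" "distinct xs" "set xs = A" "hd xs = a" "last xs = b"
      "path_time l1_dist xs = real (length xs) - 1"
    using assms unfolding unit_path_def by blast
  then show ?thesis
    unfolding unit_path_def by (intro exI[of _ "rev xs"]) (simp add: pt hd_rev last_rev)
qed

lemma unit_path_row_right:
  assumes "l \<le> u"
  shows "unit_path ({l..u} \<times> {y}) (l, y) (u, y)"
  using unit_path_swap[OF unit_path_column_up[OF assms, of y]] by (simp add: product_swap)

text \<open>
  Rows are added in pairs, so that the path returns to the column of \<open>x\<close> and can be continued there.
\<close>

lemma unit_path_zigzag_rows:
  assumes "unit_path A a (x, y)" "x \<le> z" "A \<inter> {x..z} \<times> {y<..} = {}"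
  shows "unit_path (A \<union> {x..z} \<times> {y<..y + 2 * int j}) a (x, y + 2 * int j)"
proof (induction j)
  case 0
  then show ?case using assms by simp
next
  case (Suc j)
  let ?v = "y + 2 * int j"
  have "unit_path (A \<union> {x..z} \<times> {y<..?v} \<union> {x..z} \<times> {?v + 1}) a (z, ?v + 1)"
    using assms by (intro unit_path_append[OF Suc unit_path_row_right]) (auto simp: l1_dist_def)
  then have "unit_path (A \<union> {x..z} \<times> {y<..?v} \<union> {x..z} \<times> {?v + 1} \<union> {x..z} \<times> {?v + 2})
      a (x, ?v + 2)"
    by (rule unit_path_append[OF _ unit_path_rev[OF unit_path_row_right[OF assms(2)]]])
      (use assms in \<open>auto simp: l1_dist_def\<close>)
  moreover have "A \<union> {x..z} \<times> {y<..?v} \<union> {x..z} \<times> {?v + 1} \<union> {x..z} \<times> {?v + 2}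
      = A \<union> {x..z} \<times> {y<..y + 2 * int (Suc j)}"
    by auto
  ultimately show ?case by (simp add: algebra_simps)
qed

lemma unit_path_zigzag_columns_left:
  assumes "unit_path A a (x, y)" "y \<le> z" "A \<inter> {..<x} \<times> {y..z} = {}"
  shows "unit_path (A \<union> {x - 2 * int j..<x} \<times> {y..z}) a (x - 2 * int j, y)"
proof (induction j)
  case 0
  then show ?case using assms by simp
next
  case (Suc j)
  let ?v = "x - 2 * int j"
  have "unit_path (A \<union> {?v..<x} \<times> {y..z} \<union> {?v - 1} \<times> {y..z}) a (?v - 1, z)"
    using assms by (intro unit_path_append[OF Suc unit_path_column_up]) (auto simp: l1_dist_def)
  then have "unit_path (A \<union> {?v..<x} \<times> {y..z} \<union> {?v - 1} \<times> {y..z} \<union> {?v - 2} \<times> {y..z})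
      a (?v - 2, y)"
    by (rule unit_path_append[OF _ unit_path_rev[OF unit_path_column_up[OF assms(2)]]])
      (use assms in \<open>auto simp: l1_dist_def\<close>)
  moreover have "A \<union> {?v..<x} \<times> {y..z} \<union> {?v - 1} \<times> {y..z} \<union> {?v - 2} \<times> {y..z}
      = A \<union> {x - 2 * int (Suc j)..<x} \<times> {y..z}"
    by auto
  ultimately show ?case by (simp add: algebra_simps)
qed

text \<open>
  From (1,1) to (1,2) is the best choice of ends: the depot is at distances 2 and 3, so the tour
  attains the bound of \<open>depot_round_trip_ge\<close>.
\<close>

lemma unit_path_tour:
  assumes "unit_path A (1, 1) (1, 2)"
  obtains r where "r \<noteq> []" "distinct r" "set r = A"
    "round_trip l1_dist depot r = real (card A) + 4"
proof -
  obtain r where r: "r \<noteq> []" "distinct r" "set r = A" "hd r = (1, 1)" "last r = (1, 2)"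
      "path_time l1_dist r = real (length r) - 1"
    using assms unfolding unit_path_def by blast
  have "round_trip l1_dist depot r = real (card A) + 4"
    using r path_time_append[of "[depot]" "r @ [depot]" l1_dist]
      path_time_append[of r "[depot]" l1_dist] distinct_card[OF r(2)]
    by (simp add: round_trip_def l1_dist_def depot_def)
  with r that show thesis by blast
qed

text \<open>
  Along the bottom row to the right, then zigzag through the columns above it back to the left. An
  even number of columns makes the last one run downwards, to (1,2).
\<close>

lemma unit_path_whole_grid:
  "unit_path ({1..2 * int j + 2} \<times> {1..2 * int j + 2}) (1, 1) (1, 2)"
proof -
  let ?N = "2 * int j + 2"
  have "unit_path ({1..?N} \<times> {1}) (1, 1) (?N, 1)"
    by (intro unit_path_row_right) auto
  then have "unit_path ({1..?N} \<times> {1} \<union> {?N} \<times> {2..?N}) (1, 1) (?N, ?N)"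
    by (rule unit_path_append[OF _ unit_path_column_up]) (auto simp: l1_dist_def)
  then have "unit_path ({1..?N} \<times> {1} \<union> {?N} \<times> {2..?N} \<union> {?N - 1} \<times> {2..?N}) (1, 1) (?N - 1, 2)"
    by (rule unit_path_append[OF _ unit_path_rev[OF unit_path_column_up]]) (auto simp: l1_dist_def)
  then have "unit_path ({1..?N} \<times> {1} \<union> {?N} \<times> {2..?N} \<union> {?N - 1} \<times> {2..?N}
      \<union> {?N - 1 - 2 * int j..<?N - 1} \<times> {2..?N}) (1, 1) (?N - 1 - 2 * int j, 2)"
    by (rule unit_path_zigzag_columns_left) auto
  moreover have "{1..?N} \<times> {1} \<union> {?N} \<times> {2..?N} \<union> {?N - 1} \<times> {2..?N}
      \<union> {?N - 1 - 2 * int j..<?N - 1} \<times> {2..?N} = {1..?N} \<times> {1..?N}"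
    by auto
  ultimately show ?thesis by (simp del: Un_assoc)
qed

text \<open>
  The two unit squares stacked at the lower right corner of the grid, each without the point at
  which the vehicle stops: (N - 1, 2) and (N - 1, 3). These stops are adjacent to each other and
  to the column to their left.
\<close>

definition lower_tromino :: "int \<Rightarrow> point set" where
  "lower_tromino N = {(N - 1, 1), (N, 1), (N, 2)}"

definition upper_tromino :: "int \<Rightarrow> point set" where
  "upper_tromino N = {(N, 3), (N, 4), (N - 1, 4)}"

text \<open>
  Column \<open>N - 2\<close> is climbed with a detour through the two stops, between heights 2 and 3. Above
  height 4 the rest of the last three columns is covered by a zigzag, which leaves an odd number
  of columns to be swept from right to left. For \<open>N = 4\<close> both zigzags are empty:
  (1,1), (2,1), (2,2), (3,2), (3,3), (2,3), (2,4), (1,4), (1,3), (1,2).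
\<close>

lemma unit_path_without_trominoes:
  fixes j :: nat
  defines "N \<equiv> 2 * int j + 4"
  shows "unit_path ({1..N} \<times> {1..N} - (lower_tromino N \<union> upper_tromino N)) (1, 1) (1, 2)"
proof -
  let ?M = "N - 2"
  have N: "N \<ge> 4" by (simp add: N_def)
  let ?A1 = "{1..?M} \<times> {1::int}"
  let ?A2 = "?A1 \<union> {(?M, 2)}"
  let ?A3 = "?A2 \<union> {?M + 1} \<times> {2..3}"
  let ?A4 = "?A3 \<union> {?M} \<times> {3..4}"
  let ?A5 = "?A4 \<union> {?M..N} \<times> {4<..4 + 2 * int j}"
  let ?A6 = "?A5 \<union> {?M - 1} \<times> {2..N}"
  let ?A7 = "?A6 \<union> {?M - 1 - 2 * int j..<?M - 1} \<times> {2..N}"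
  have "unit_path ?A1 (1, 1) (?M, 1)"
    using N by (intro unit_path_row_right) auto
  then have "unit_path ?A2 (1, 1) (?M, 2)"
    by (rule unit_path_append[OF _ unit_path_single]) (auto simp: l1_dist_def)
  then have "unit_path ?A3 (1, 1) (?M + 1, 3)"
    by (rule unit_path_append[OF _ unit_path_column_up]) (auto simp: l1_dist_def)
  then have "unit_path ?A4 (1, 1) (?M, 4)"
    by (rule unit_path_append[OF _ unit_path_column_up]) (auto simp: l1_dist_def)
  then have "unit_path ?A5 (1, 1) (?M, 4 + 2 * int j)"
    using N by (intro unit_path_zigzag_rows) auto
  then have "unit_path ?A6 (1, 1) (?M - 1, 2)"
    by (rule unit_path_append[OF _ unit_path_rev[OF unit_path_column_up]])
      (use N in \<open>auto simp: l1_dist_def N_def\<close>)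
  then have "unit_path ?A7 (1, 1) (?M - 1 - 2 * int j, 2)"
    using N by (intro unit_path_zigzag_columns_left) auto
  moreover have "?A7 = {1..N} \<times> {1..N} - (lower_tromino N \<union> upper_tromino N)"
  proof (rule set_eqI)
    fix c :: point
    obtain x y where c: "c = (x, y)" by (cases c)
    have j: "2 * int j = N - 4" by (simp add: N_def)
    consider "x < N - 3" | "x = N - 3" | "x = N - 2" | "x = N - 1" | "x = N" | "x > N" by linarith
    then show "c \<in> ?A7 \<longleftrightarrow> c \<in> {1..N} \<times> {1..N} - (lower_tromino N \<union> upper_tromino N)"
      unfolding c j lower_tromino_def upper_tromino_def using N by cases (simp; arith)+
  qed
  ultimately show ?thesis by (simp add: N_def)
qed

section \<open>Parking at some customers and walking to the others\<close>

definition walk_groups_solution ::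
  "point list \<Rightarrow> point set set \<Rightarrow> (point set \<Rightarrow> point) \<Rightarrow> solution" where
  "walk_groups_solution r G g = \<lparr>route = r, service_sets = (\<lambda>c. {c}) ` set r \<union> G,
     parked_at = (\<lambda>\<sigma>. if \<sigma> \<in> G then g \<sigma> else the_elem \<sigma>)\<rparr>"

lemma set_walk_time_own: "set_walk_time I c {c} \<le> 0"
  using set_walk_time_le[of "[c]" "{c}" I c] by (simp only: round_trip_walk) (simp add: round_trip_def l1_dist_def)

text \<open>
  With \<open>G = {}\<close> this is the solution that parks at every customer.
\<close>

lemma walk_groups_solution:
  assumes r: "r \<noteq> []" "distinct r" "set r = customers I - \<Union>G"
    and G: "partition_on (\<Union>G) G" "\<Union>G \<subseteq> customers I"
    and cap: "capacity I \<ge> 1" "\<And>\<sigma>. \<sigma> \<in> G \<Longrightarrow> card \<sigma> \<le> capacity I"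
    and g: "\<And>\<sigma>. \<sigma> \<in> G \<Longrightarrow> g \<sigma> \<in> set r"
    and t: "\<And>\<sigma>. \<sigma> \<in> G \<Longrightarrow> set_walk_time I (g \<sigma>) \<sigma> \<le> u"
  shows "feasible I (walk_groups_solution r G g)"
    and "completion_time I (walk_groups_solution r G g)
      \<le> round_trip (drive I) depot r + real (length r) * park_time I + real (card G) * u
        + real ((side I)\<^sup>2) * load_time I"
proof -
  have dj: "{c} \<notin> G" if "c \<in> set r" for c using that r(3) by auto
  have "partition_on (set r) ((\<lambda>c. {c}) ` set r)"
    by (rule partition_on_singletons)
  then have "partition_on (set r \<union> \<Union>G) ((\<lambda>c. {c}) ` set r \<union> G)"
    using G(1) r(3) by (auto simp: partition_on_def intro!: disjoint_union)
  moreover have "set r \<union> \<Union>G = customers I" using r(3) G(2) by auto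
  ultimately show "feasible I (walk_groups_solution r G g)"
    using r cap g dj by (auto simp: feasible_def walk_groups_solution_def)
  let ?t = "\<lambda>\<sigma>. set_walk_time I (if \<sigma> \<in> G then g \<sigma> else the_elem \<sigma>) \<sigma>"
  have "finite G" using G finite_customers finite_subset finite_UnionD by metis
  moreover have "(\<lambda>c. {c}) ` set r \<inter> G = {}" using dj by auto
  ultimately have "sum ?t ((\<lambda>c. {c}) ` set r \<union> G) = sum ?t ((\<lambda>c. {c}) ` set r) + sum ?t G"
    by (intro sum.union_disjoint) auto
  moreover have "sum ?t ((\<lambda>c. {c}) ` set r) \<le> 0"
    by (intro sum_nonpos) (auto simp: dj set_walk_time_own)
  moreover have "sum ?t G \<le> real (card G) * u"
    by (intro sum_bounded_above) (simp add: t)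
  ultimately show "completion_time I (walk_groups_solution r G g)
      \<le> round_trip (drive I) depot r + real (length r) * park_time I + real (card G) * u
        + real ((side I)\<^sup>2) * load_time I"
    by (simp add: completion_time_def walk_groups_solution_def)
qed

section \<open>The two regimes\<close>

lemma tsp_solution_completion_time_ge:
  assumes s: "tsp_solution I s" and N: "side I \<ge> 2"
    and l: "block_length I > 0" and d: "0 < drive_rate I" and w: "0 \<le> walk_rate I"
  shows "completion_time I s \<ge> block_length I * drive_rate I * (real ((side I)\<^sup>2) + 4)
    + real ((side I)\<^sup>2) * park_time I + real ((side I)\<^sup>2) * load_time I"
proof -
  have f: "feasible I s" and r: "distinct (route s)" "set (route s) = customers I"
    using s by (auto simp: tsp_solution_def optimal_tsp_tour_def is_arg_min_def)
  have len: "length (route s) = (side I)\<^sup>2"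
    using distinct_card[OF r(1)] r(2) card_customers by simp
  have "2\<^sup>2 \<le> (side I)\<^sup>2" using N by (rule power_mono) simp
  then have "length (route s) \<ge> 2" using len by simp
  then have "round_trip l1_dist depot (route s) \<ge> real ((side I)\<^sup>2) + 4"
    using depot_round_trip_ge[of "route s" I] r len by simp
  then have "round_trip (drive I) depot (route s)
      \<ge> block_length I * drive_rate I * (real ((side I)\<^sup>2) + 4)"
    unfolding round_trip_drive using l d by (intro mult_left_mono) auto
  moreover have "set_walk_time I (parked_at s \<sigma>) \<sigma> \<ge> 0" if \<sigma>: "\<sigma> \<in> service_sets s" for \<sigma>
  proof -
    obtain cs where
      "set_walk_time I (parked_at s \<sigma>) \<sigma>
        = block_length I * walk_rate I * round_trip l1_dist (parked_at s \<sigma>) cs"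
      using set_walk_time_attained[OF feasible_finite(2)[OF f \<sigma>]] .
    then show ?thesis using l w by (simp add: round_trip_def path_time_ge_0)
  qed
  ultimately show ?thesis
    using sum_nonneg[of "service_sets s" "\<lambda>\<sigma>. set_walk_time I (parked_at s \<sigma>) \<sigma>"]
    by (simp add: completion_time_def len)
qed

lemma tsp_solution_optimal:
  assumes ev: "even (side I)" and N: "side I \<ge> 4" and q: "capacity I = 3"
    and l: "block_length I > 0" and d: "0 < drive_rate I" and dw: "drive_rate I \<le> walk_rate I"
    and p: "park_time I \<le> block_length I * (4/3 * walk_rate I - drive_rate I)"
  shows "\<exists>s. optimal I s \<and> tsp_solution I s"
proof -
  obtain h where "side I = 2 * h" using ev by (elim evenE)
  then obtain j where j: "side I = 2 * j + 2" using N that[of "h - 1"] by simp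
  have "unit_path (customers I) (1, 1) (1, 2)"
    using unit_path_whole_grid[of j] by (simp add: customers_def j add.commute)
  then obtain r where r: "r \<noteq> []" "distinct r" "set r = customers I"
    "round_trip l1_dist depot r = real ((side I)\<^sup>2) + 4"
    using unit_path_tour[of "customers I"] by (metis card_customers)
  define s where "s = walk_groups_solution r {} (\<lambda>_. depot)"
  have len: "length r' = (side I)\<^sup>2" if "distinct r'" "set r' = customers I" for r'
    using that distinct_card[of r'] card_customers by simp
  have "4\<^sup>2 \<le> (side I)\<^sup>2" using N by (rule power_mono) simp
  then have tour: "round_trip (drive I) depot r \<le> round_trip (drive I) depot r'"
    if "distinct r'" "set r' = customers I" for r'
    unfolding round_trip_drive r(4)
    using that len[OF that] depot_round_trip_ge[of r' I] l d by (intro mult_left_mono) auto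
  have s: "feasible I s" and
    cost: "completion_time I s \<le> round_trip (drive I) depot r + real (length r) * park_time I
      + real ((side I)\<^sup>2) * load_time I"
    unfolding s_def
    using walk_groups_solution[of r I "{}" "\<lambda>_. depot" 0] r q by (auto simp: partition_on_def)
  have "completion_time I s \<le> completion_time I s'" if "feasible I s'" for s'
    using completion_time_ge[OF that N q l d dw p] cost len[OF r(2,3)]
    by (simp add: round_trip_drive r(4))
  then have "optimal I s"
    using s by (auto simp: optimal_def is_arg_min_def not_less)
  moreover have "tsp_solution I s"
    using s r tour
    by (auto simp: tsp_solution_def optimal_tsp_tour_def is_arg_min_def s_def
        walk_groups_solution_def not_less)
  ultimately show ?thesis by blast
qed

text \<open>
  Closing the walk takes a single step, so a group of three is served with 4 blocks of walking:
  the walk for which \<open>set_walk_time_ge_card\<close> is sharp.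
\<close>

lemma walk_square:
  assumes "\<sigma> = {a, b, c}" "distinct [a, b, c]"
    "l1_dist i a = 1" "l1_dist a b = 1" "l1_dist b c = 1" "l1_dist c i = 1"
  shows "set_walk_time I i \<sigma> \<le> block_length I * walk_rate I * 4"
proof -
  have "round_trip l1_dist i [a, b, c] = 4" using assms by (simp add: round_trip_def)
  then show ?thesis
    using set_walk_time_le[of "[a, b, c]" \<sigma> I i] assms(1,2) by (simp add: round_trip_walk)
qed

text \<open>
  The bound on the right is the cost of parking everywhere. On the 2-by-2 grid the single stop
  saves 4 blocks of driving and 3 stops for 4 blocks of walking.
\<close>

lemma walking_beats_tsp:
  assumes ev: "even (side I)" and N: "side I > 0" and q: "capacity I = 3"
    and l: "block_length I > 0" and d: "0 < drive_rate I"
    and p: "park_time I > block_length I * (4/3 * walk_rate I - drive_rate I)"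
  obtains s where "feasible I s"
    "completion_time I s < block_length I * drive_rate I * (real ((side I)\<^sup>2) + 4)
      + real ((side I)\<^sup>2) * park_time I + real ((side I)\<^sup>2) * load_time I"
proof (cases "side I = 2")
  case True
  have C: "customers I = {(1,1),(1,2),(2,1),(2,2)}"
  proof -
    have "{1..2::int} = {1,2}" by auto
    then show ?thesis using True by (auto simp: customers_def)
  qed
  let ?G = "{{(1,2),(2,2),(2,1)}} :: point set set"
  let ?s = "walk_groups_solution [(1,1)] ?G (\<lambda>_. (1,1))"
  have w: "set_walk_time I (1,1) {(1,2),(2,2),(2,1)} \<le> block_length I * walk_rate I * 4"
    by (rule walk_square[of _ "(1,2)" "(2,2)" "(2,1)"]) (auto simp: l1_dist_def)
  note sol = walk_groups_solution[of "[(1,1)]" I ?G "\<lambda>_. (1,1)" "block_length I * walk_rate I * 4"]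
  have "feasible I ?s"
    by (rule sol(1)) (auto simp: C q w partition_on_def)
  moreover have "completion_time I ?s \<le> round_trip (drive I) depot [(1,1)]
      + real (length [(1::int,1::int)]) * park_time I
      + real (card ?G) * (block_length I * walk_rate I * 4) + real ((side I)\<^sup>2) * load_time I"
    by (rule sol(2)) (auto simp: C q w partition_on_def)
  moreover have "round_trip l1_dist depot [(1,1)] = 4"
    by (simp add: round_trip_def l1_dist_def depot_def)
  moreover have "block_length I * drive_rate I > 0" using l d by simp
  ultimately show thesis using p that[of ?s] True by (simp add: round_trip_drive algebra_simps)
next
  case False
  obtain h where "side I = 2 * h" using ev by (elim evenE)
  then obtain j where j: "side I = 2 * j + 4" using N False that[of "h - 2"] by simp
  define M where "M = int (side I)"
  have M: "M = 2 * int j + 4" using j by (simp add: M_def)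
  let ?T1 = "lower_tromino M" and ?T2 = "upper_tromino M"
  let ?G = "{?T1, ?T2}"
  let ?g = "\<lambda>\<sigma>. if \<sigma> = ?T1 then (M - 1, 2) else (M - 1, 3)"
  have ne: "(M, 1) \<in> ?T1 - ?T2" "?T1 \<inter> ?T2 = {}" by (auto simp: lower_tromino_def upper_tromino_def)
  then have ne': "?T1 \<noteq> ?T2" by blast
  have C: "customers I = {1..M} \<times> {1..M}" by (simp add: customers_def M_def)
  have sub: "?T1 \<union> ?T2 \<subseteq> customers I" using M by (auto simp: C lower_tromino_def upper_tromino_def)
  have card3: "card ?T1 = 3" "card ?T2 = 3" by (auto simp: lower_tromino_def upper_tromino_def)
  have fin: "finite ?T1" "finite ?T2" by (auto simp: lower_tromino_def upper_tromino_def)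
  have six: "card (?T1 \<union> ?T2) = 6" using card_Un_disjoint[OF fin ne(2)] card3 by simp
  then have le: "6 \<le> (side I)\<^sup>2"
    using card_mono[OF finite_customers sub] card_customers by simp
  have card: "real (card (customers I - (?T1 \<union> ?T2))) = real ((side I)\<^sup>2) - 6"
    using card_Diff_subset[OF _ sub] fin six card_customers le by (simp add: of_nat_diff)
  have "unit_path (customers I - (?T1 \<union> ?T2)) (1, 1) (1, 2)"
    unfolding C using unit_path_without_trominoes[of j] by (simp add: M)
  then obtain r where r: "r \<noteq> []" "distinct r" "set r = customers I - (?T1 \<union> ?T2)"
    "round_trip l1_dist depot r = real ((side I)\<^sup>2) - 6 + 4"
    by (rule unit_path_tour) (simp only: card)
  have len: "real (length r) = real ((side I)\<^sup>2) - 6"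
    using distinct_card[OF r(2)] r(3) card by simp
  have gr: "?g \<sigma> \<in> set r" if "\<sigma> \<in> ?G" for \<sigma>
    using M unfolding r(3) by (auto simp: C lower_tromino_def upper_tromino_def)
  have "set_walk_time I (M - 1, 2) ?T1 \<le> block_length I * walk_rate I * 4"
    by (rule walk_square[of _ "(M - 1, 1)" "(M, 1)" "(M, 2)"]) (auto simp: l1_dist_def lower_tromino_def)
  moreover have "set_walk_time I (M - 1, 3) ?T2 \<le> block_length I * walk_rate I * 4"
    by (rule walk_square[of _ "(M, 3)" "(M, 4)" "(M - 1, 4)"]) (auto simp: l1_dist_def upper_tromino_def)
  ultimately have t: "set_walk_time I (?g \<sigma>) \<sigma> \<le> block_length I * walk_rate I * 4" if "\<sigma> \<in> ?G" for \<sigma>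
    using that ne' by auto
  have part: "partition_on (\<Union>?G) ?G"
    using ne ne' card3 by (auto simp: partition_on_def disjoint_def)
  have r3: "set r = customers I - \<Union>?G" and sub': "\<Union>?G \<subseteq> customers I" using r(3) sub by auto
  have cap: "card \<sigma> \<le> capacity I" if "\<sigma> \<in> ?G" for \<sigma>
    using that q card3 by auto
  have q1: "capacity I \<ge> 1" using q by simp
  note sol = walk_groups_solution[OF r(1,2) r3 part sub' q1 cap gr t]
  have "completion_time I (walk_groups_solution r ?G ?g)
      \<le> block_length I * drive_rate I * (real ((side I)\<^sup>2) - 6 + 4)
        + (real ((side I)\<^sup>2) - 6) * park_time I + 2 * (block_length I * walk_rate I * 4)
        + real ((side I)\<^sup>2) * load_time I"
    using sol(2) ne' len by (simp add: round_trip_drive r(4))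
  moreover have "feasible I (walk_groups_solution r ?G ?g)"
    by (rule sol(1))
  ultimately show thesis using p that[of "walk_groups_solution r ?G ?g"] by (simp add: algebra_simps)
qed

theorem claim2:
  fixes I :: grid_cdpp
  assumes "even (side I)" and "side I > 0"
    and "block_length I > 0"
    and "0 < drive_rate I" and "drive_rate I \<le> walk_rate I"
    and "park_time I \<ge> 0" and "load_time I \<ge> 0"
    and "capacity I = 3"
  shows "(side I \<noteq> 2 \<and> park_time I \<le> block_length I * (4/3 * walk_rate I - drive_rate I)
            \<longrightarrow> (\<exists>s. optimal I s \<and> tsp_solution I s))
       \<and> (park_time I > block_length I * (4/3 * walk_rate I - drive_rate I)
            \<longrightarrow> (\<forall>s. tsp_solution I s \<longrightarrow> \<not> optimal I s))"
proof (intro conjI impI allI)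
  assume p: "side I \<noteq> 2 \<and> park_time I \<le> block_length I * (4/3 * walk_rate I - drive_rate I)"
  then have "side I \<ge> 4" using assms(1,2) by (auto elim!: evenE)
  then show "\<exists>s. optimal I s \<and> tsp_solution I s"
    using tsp_solution_optimal[of I] assms p by simp
next
  fix s
  assume p: "park_time I > block_length I * (4/3 * walk_rate I - drive_rate I)"
    and s: "tsp_solution I s"
  have "side I \<ge> 2" using assms(1,2) by (auto elim!: evenE)
  then have "completion_time I s \<ge> block_length I * drive_rate I * (real ((side I)\<^sup>2) + 4)
      + real ((side I)\<^sup>2) * park_time I + real ((side I)\<^sup>2) * load_time I"
    using tsp_solution_completion_time_ge[OF s] assms by simp
  moreover obtain s' where "feasible I s'"
    "completion_time I s' < block_length I * drive_rate I * (real ((side I)\<^sup>2) + 4)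
      + real ((side I)\<^sup>2) * park_time I + real ((side I)\<^sup>2) * load_time I"
    using walking_beats_tsp[OF assms(1,2,8,3,4) p] by blast
  ultimately show "\<not> optimal I s" by (auto simp: optimal_def is_arg_min_def)
qed

end
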